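(* Let $X$ be a semi-rectifiable compact plane set, let $\mathcal{F}$ be an effective collection of paths in $X$, and let $f,g\in D_{\mathcal{F}}^{(1)}(X)$ be such that $0\notin g(X)$. Then $f/g\in D_{\mathcal{F}}^{(1)}(X)$ and $(f/g)^{[1]}=(gf^{[1]}-fg^{[1]})/g^2$.
   Context: A compact plane set is a non-empty compact subset of $\mathbb{C}$. $C(X)$ is the algebra of continuous complex-valued functions on $X$. Paths: A path is a continuous map $\gamma:[a,b]\to\mathbb{C}$ with $a<b$ real; $\gamma^-=\gamma(a)$, $\gamma^+=\gamma(b)$, and $\gamma^*=\gamma([a,b])$; $\gamma$ is a path in $X$ if $\gamma^*\subseteq X$. A subpath of $\gamma$ is a restriction of $\gamma$ to a non-degenerate closed subinterval of $[a,b]$. $\gamma$ is rectifiable if its total variation is finite, a Jordan path if it is injective, and admissible if it is rectifiable and has no constant subpaths. Integrals $\int_\gamma f(z)\,dz$ along rectifiable paths are Riemann–Stieltjes integrals. A compact plane set $X$ is semi-rectifiable if the union of the images of all rectifiable Jordan paths in $X$ is dense in $X$. A collection $\mathcal{F}$ of paths in $X$ is effective if $\bigcup_{\gamma\in\mathcal{F}}\gamma^*$ is dense in $X$, each path in $\mathcal{F}$ is admissible, and every subpath of a path in $\mathcal{F}$ belongs to $\mathcal{F}$. $\mathcal{F}$-derivatives: For $f\in C(X)$, a function $g\in C(X)$ is an $\mathcal{F}$-derivative of $f$ if $\int_\gamma g(z)\,dz=f(\gamma^+)-f(\gamma^-)$ for each $\gamma\in\mathcal{F}$; $f$ is $\mathcal{F}$-differentiable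 if it has an $\mathcal{F}$-derivative. When $X$ is semi-rectifiable and $\mathcal{F}$ is effective, the $\mathcal{F}$-derivative is unique and is denoted $f^{[1]}$; $D_{\mathcal{F}}^{(1)}(X)$ is the set of all $\mathcal{F}$-differentiable functions in $C(X)$. *)

theory Defs
  imports "HOL-Analysis.Analysis"
begin

definition compact_plane_set :: "complex set \<Rightarrow> bool" where
  "compact_plane_set X \<longleftrightarrow> compact X \<and> X \<noteq> {}"

text \<open>
  A map with domain \<open>S\<close> is represented by the total function that agrees with it on \<open>S\<close> and
  is \<open>undefined\<close> elsewhere (\<^const>\<open>extensional\<close>), so that equality of maps is HOL equality.
\<close>

definition cont_functions :: "complex set \<Rightarrow> (complex \<Rightarrow> complex) set" where
  "cont_functions X = {f \<in> extensional X. continuous_on X f}"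

text \<open>
  A triple \<open>(a, b, \<gamma>)\<close> stands for the map \<open>\<gamma> : [a,b] \<rightarrow> \<complex>\<close>. The library's \<^const>\<open>path\<close> is
  not used since its parameter interval is always \<open>[0,1]\<close>, so that a subpath in the sense of a
  restriction would not be a path.
\<close>

type_synonym plane_path = "real \<times> real \<times> (real \<Rightarrow> complex)"

fun is_path :: "plane_path \<Rightarrow> bool" where
  "is_path (a, b, \<gamma>) \<longleftrightarrow> a < b \<and> \<gamma> \<in> extensional {a..b} \<and> continuous_on {a..b} \<gamma>"

fun path_img :: "plane_path \<Rightarrow> complex set" where
  "path_img (a, b, \<gamma>) = \<gamma> ` {a..b}"

fun subpaths :: "plane_path \<Rightarrow> plane_path set" where
  "subpaths (a, b, \<gamma>) = {(c, d, restrict \<gamma> {c..d}) | c d. a \<le> c \<and> c < d \<and> d \<le> b}"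

fun constant_path :: "plane_path \<Rightarrow> bool" where
  "constant_path (a, b, \<gamma>) \<longleftrightarrow> \<gamma> constant_on {a..b}"

text \<open>
  Partitions of \<open>[a,b]\<close> are the library's divisions; these may contain degenerate
  intervals, which contribute \<open>0\<close> to the sums below.
\<close>

fun total_variation :: "plane_path \<Rightarrow> ereal" where
  "total_variation (a, b, \<gamma>) =
     (SUP \<D>\<in>{\<D>. \<D> division_of {a..b}}. ereal (\<Sum>K\<in>\<D>. norm (\<gamma> (Sup K) - \<gamma> (Inf K))))"

definition rectifiable :: "plane_path \<Rightarrow> bool" where
  "rectifiable \<Gamma> \<longleftrightarrow> total_variation \<Gamma> < \<infinity>"

fun jordan :: "plane_path \<Rightarrow> bool" where
  "jordan (a, b, \<gamma>) \<longleftrightarrow> inj_on \<gamma> {a..b}"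

definition admissible :: "plane_path \<Rightarrow> bool" where
  "admissible \<Gamma> \<longleftrightarrow> rectifiable \<Gamma> \<and> (\<forall>\<Delta>\<in>subpaths \<Gamma>. \<not> constant_path \<Delta>)"

definition paths_in :: "complex set \<Rightarrow> plane_path set" where
  "paths_in X = {\<Gamma>. is_path \<Gamma> \<and> path_img \<Gamma> \<subseteq> X}"

definition dense_in :: "complex set \<Rightarrow> complex set \<Rightarrow> bool" where
  "dense_in S X \<longleftrightarrow> S \<subseteq> X \<and> X \<subseteq> closure S"

definition semi_rectifiable :: "complex set \<Rightarrow> bool" where
  "semi_rectifiable X \<longleftrightarrow>
     dense_in (\<Union>\<Gamma>\<in>{\<Gamma> \<in> paths_in X. rectifiable \<Gamma> \<and> jordan \<Gamma>}. path_img \<Gamma>) X"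

definition effective :: "complex set \<Rightarrow> plane_path set \<Rightarrow> bool" where
  "effective X \<F> \<longleftrightarrow>
     dense_in (\<Union>\<Gamma>\<in>\<F>. path_img \<Gamma>) X \<and>
     (\<forall>\<Gamma>\<in>\<F>. admissible \<Gamma>) \<and>
     (\<forall>\<Gamma>\<in>\<F>. subpaths \<Gamma> \<subseteq> \<F>)"

text \<open>
  The Riemann--Stieltjes integral \<open>\<integral>\<^sub>\<gamma> f(z) dz\<close> exists and equals \<open>I\<close>: the sums
  \<open>\<Sum> f(\<gamma>(t)) (\<gamma>(sup K) - \<gamma>(inf K))\<close> over tagged intervals \<open>(t, K)\<close> tend to \<open>I\<close> as the mesh of the tagged partition tends
  to \<open>0\<close>. The library's \<open>has_contour_integral\<close> is not suitable: it integrates against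
  the derivative of \<open>\<gamma>\<close>, which for a merely rectifiable path need not recover \<open>\<gamma>\<close>.
\<close>

fun has_path_integral :: "(complex \<Rightarrow> complex) \<Rightarrow> complex \<Rightarrow> plane_path \<Rightarrow> bool" where
  "has_path_integral f I (a, b, \<gamma>) \<longleftrightarrow>
     (\<forall>\<epsilon>>0. \<exists>\<delta>>0. \<forall>p. p tagged_division_of {a..b} \<and> (\<forall>(t, K)\<in>p. Sup K - Inf K < \<delta>) \<longrightarrow>
        norm ((\<Sum>(t, K)\<in>p. f (\<gamma> t) * (\<gamma> (Sup K) - \<gamma> (Inf K))) - I) < \<epsilon>)"

definition F_derivative ::
  "complex set \<Rightarrow> plane_path set \<Rightarrow> (complex \<Rightarrow> complex) \<Rightarrow> (complex \<Rightarrow> complex) \<Rightarrow> bool" where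
  "F_derivative X \<F> f g \<longleftrightarrow>
     f \<in> cont_functions X \<and> g \<in> cont_functions X \<and>
     (\<forall>(a, b, \<gamma>)\<in>\<F>. has_path_integral g (f (\<gamma> b) - f (\<gamma> a)) (a, b, \<gamma>))"

definition F_differentiable_functions ::
  "complex set \<Rightarrow> plane_path set \<Rightarrow> (complex \<Rightarrow> complex) set" where
  "F_differentiable_functions X \<F> = {f \<in> cont_functions X. \<exists>g. F_derivative X \<F> f g}"

text \<open>Meaningful when the derivative is unique, e.g. when \<open>\<F>\<close> is effective.\<close>

definition F_deriv ::
  "complex set \<Rightarrow> plane_path set \<Rightarrow> (complex \<Rightarrow> complex) \<Rightarrow> complex \<Rightarrow> complex" where
  "F_deriv X \<F> f = (THE g. F_derivative X \<F> f g)"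

end

theory Submission
  imports Defs
begin

text \<open>
  Everything rests on replacing the integral condition on a path \<open>\<gamma>\<close> by a first-order estimate
  for increments. For \<open>\<gamma> : [a,b] \<rightarrow> \<complex>\<close> of finite variation choose a real function \<open>W\<close> with
  \<open>\<bar>\<gamma> d - \<gamma> c\<bar> \<le> W d - W c\<close> for \<open>c \<le> d\<close>; the variation of \<open>\<gamma>\<close> on \<open>[a,t]\<close> is such a \<open>W t\<close>. If \<open>f'\<close>
  is an \<open>\<F>\<close>-derivative of \<open>f\<close>, then the integral condition on the subpaths of \<open>\<gamma>\<close> and the uniform
  continuity of \<open>f' \<circ> \<gamma>\<close> give
  \<open>f (\<gamma> d) - f (\<gamma> c) = f' (\<gamma> t) (\<gamma> d - \<gamma> c) + o(1) (W d - W c)\<close> for \<open>c \<le> t \<le> d\<close>, uniformly as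
  \<open>d - c \<rightarrow> 0\<close>. Conversely, the errors in such an estimate add up to
  \<open>o(1) (W b - W a)\<close> over a partition of \<open>[a,b]\<close> while the increments of \<open>f \<circ> \<gamma>\<close> telescope, so
  the Riemann--Stieltjes sums of \<open>f' \<circ> \<gamma>\<close> tend to \<open>f(\<gamma> b) - f(\<gamma> a)\<close>. Increment estimates obey the
  quotient rule by the calculation familiar from ordinary derivatives
  (\<open>increment_estimate_divide\<close>), and this shows that the expected function is an
  \<open>\<F>\<close>-derivative of the quotient.

  To identify it with the chosen derivative, uniqueness is needed
  (\<open>F_derivative_unique\<close>). Where two derivatives of one function differ at a point of a path,
  comparing the two integrals near that point shows that if \<open>W\<close> bounds the increments of
  \<open>\<gamma>\<close> there, then so does \<open>W / 2\<close>. Iteration makes \<open>\<gamma>\<close> constant near that point, which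
  admissibility forbids. So the derivatives agree on a dense subset of \<open>X\<close>, and, being
  continuous, on \<open>X\<close>.
\<close>

section \<open>Bounding the increments of a rectifiable path\<close>

definition majorizes :: "(real \<Rightarrow> real) \<Rightarrow> (real \<Rightarrow> complex) \<Rightarrow> real set \<Rightarrow> bool" where
  "majorizes W \<gamma> S \<longleftrightarrow> (\<forall>c\<in>S. \<forall>d\<in>S. c \<le> d \<longrightarrow> norm (\<gamma> d - \<gamma> c) \<le> W d - W c)"

lemma majorizesD:
  "majorizes W \<gamma> S \<Longrightarrow> c \<in> S \<Longrightarrow> d \<in> S \<Longrightarrow> c \<le> d \<Longrightarrow> norm (\<gamma> d - \<gamma> c) \<le> W d - W c"
  by (simp add: majorizes_def)

lemma majorizes_subset: "majorizes W \<gamma> S \<Longrightarrow> T \<subseteq> S \<Longrightarrow> majorizes W \<gamma> T"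
  unfolding majorizes_def by blast

lemma majorizes_restrict: "majorizes W \<gamma> S \<Longrightarrow> majorizes W (restrict \<gamma> S) S"
  by (simp add: majorizes_def)

lemma division_insert_right:
  fixes a c d :: real
  assumes "D division_of {a..c}" "a \<le> c" "c < d"
  shows "insert {c..d} D division_of {a..d}" and "{c..d} \<notin> D"
proof -
  have sub: "K \<subseteq> {a..c}" if "K \<in> D" for K
    using assms(1) that by (rule division_ofD(2))
  show "{c..d} \<notin> D"
    using sub[of "{c..d}"] \<open>c < d\<close> by auto
  have disj: "interior {c..d} \<inter> interior K = {}" if "K \<in> D" for K
    using interior_mono[OF sub[OF that]] by auto
  show "insert {c..d} D division_of {a..d}"
  proof (rule division_ofI)
    show "finite (insert {c..d} D)"
      using division_ofD(1)[OF assms(1)] by simp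
    show "\<Union>(insert {c..d} D) = {a..d}"
      using division_ofD(6)[OF assms(1)] assms(2,3) by auto
  next
    fix K assume K: "K \<in> insert {c..d} D"
    show "K \<subseteq> {a..d}" using K sub assms(2,3) by fastforce
    show "K \<noteq> {}" using K division_ofD(3)[OF assms(1)] assms(3) by auto
    show "\<exists>u v. K = cbox u v"
      using K division_ofD(4)[OF assms(1)] by (metis box_real(2) insertE)
  next
    fix K L assume "K \<in> insert {c..d} D" "L \<in> insert {c..d} D" "K \<noteq> L"
    then show "interior K \<inter> interior L = {}"
      using division_ofD(5)[OF assms(1)] disj by (metis Int_commute insertE)
  qed
qed

text \<open>
  The witness is the variation function \<open>W t\<close>, the variation of the path on \<open>[a,t]\<close>: appending
  \<open>[c,d]\<close> to a division of \<open>[a,c]\<close> gives a division of \<open>[a,d]\<close>.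
\<close>

lemma rectifiable_majorant:
  assumes "rectifiable (a, b, \<gamma>)"
  obtains W where "majorizes W \<gamma> {a..b}"
proof -
  define s where "s D = (\<Sum>K\<in>D. norm (\<gamma> (Sup K) - \<gamma> (Inf K)))" for D :: "real set set"
  define W where "W t = (SUP D\<in>{D. D division_of {a..t}}. s D)" for t
  obtain B where B: "total_variation (a, b, \<gamma>) \<le> ereal B"
  proof (cases "total_variation (a, b, \<gamma>)")
    case PInf
    then show ?thesis using assms by (simp add: rectifiable_def del: total_variation.simps)
  qed (use that in auto)
  have s_le_B: "s D \<le> B" if "D division_of {a..b}" for D
  proof -
    have "ereal (s D) \<le> total_variation (a, b, \<gamma>)"
      unfolding s_def total_variation.simps using that by (intro SUP_upper) simp
    then have "ereal (s D) \<le> ereal B" using B by (rule order_trans)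
    then show ?thesis by simp
  qed
  have s_insert: "s (insert {c..d} D) = norm (\<gamma> d - \<gamma> c) + s D"
    if "D division_of {a..c}" "a \<le> c" "c < d" for c d D
    using division_insert_right(2)[OF that] division_ofD(1)[OF that(1)] that(3)
    by (simp add: s_def)
  have bdd: "bdd_above (s ` {D. D division_of {a..t}})" if "a \<le> t" "t \<le> b" for t
  proof (rule bdd_aboveI2)
    fix D assume "D \<in> {D. D division_of {a..t}}"
    then have D: "D division_of {a..t}" by simp
    show "s D \<le> B"
    proof (cases "t < b")
      case True
      have "s D \<le> s (insert {t..b} D)"
        using s_insert[OF D that(1) True] by simp
      also have "\<dots> \<le> B"
        by (rule s_le_B) (rule division_insert_right(1)[OF D that(1) True])
      finally show ?thesis .
    next
      case False
      then show ?thesis using that D s_le_B by simp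
    qed
  qed
  have "norm (\<gamma> d - \<gamma> c) \<le> W d - W c" if "a \<le> c" "c \<le> d" "d \<le> b" for c d
  proof (cases "c = d")
    case False
    then have "c < d" using that by simp
    have "W c \<le> W d - norm (\<gamma> d - \<gamma> c)"
      unfolding W_def[of c]
    proof (rule cSUP_least)
      show "{D. D division_of {a..c}} \<noteq> {}"
        using division_of_self[of a c] that(1) by (auto simp: box_real)
      fix D assume "D \<in> {D. D division_of {a..c}}"
      then have D: "D division_of {a..c}" by simp
      have "s (insert {c..d} D) \<le> W d"
        unfolding W_def using division_insert_right(1)[OF D \<open>a \<le> c\<close> \<open>c < d\<close>] that
        by (intro cSUP_upper bdd) auto
      then show "s D \<le> W d - norm (\<gamma> d - \<gamma> c)"
        using s_insert[OF D \<open>a \<le> c\<close> \<open>c < d\<close>] by simp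
    qed
    then show ?thesis by simp
  qed simp
  then have "majorizes W \<gamma> {a..b}" by (simp add: majorizes_def)
  then show ?thesis by (rule that)
qed

section \<open>Path integrals and increments\<close>

lemma tagged_division_ofE_real:
  fixes a b :: real
  assumes "p tagged_division_of {a..b}" "(t, K) \<in> p"
  obtains u v where "K = {u..v}" "a \<le> u" "u \<le> t" "t \<le> v" "v \<le> b"
proof -
  obtain u v where K: "K = {u..v}"
    using tagged_division_ofD(4)[OF assms] by (auto simp: box_real)
  have "t \<in> K" "K \<subseteq> {a..b}"
    using tagged_division_ofD(2,3)[OF assms] by auto
  then show ?thesis using that[of u v] K by auto
qed

text \<open>
  Local errors that are small relative to the increments of \<open>W\<close> add up to a small global error,
  since the increments of both \<open>F\<close> and \<open>W\<close> telescope over a partition.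
\<close>

lemma tagged_division_sum_error:
  fixes F \<phi> \<gamma> :: "real \<Rightarrow> complex" and W :: "real \<Rightarrow> real"
  assumes p: "p tagged_division_of {a..b}" and "a \<le> b"
    and err: "\<And>t u v. (t, {u..v}) \<in> p \<Longrightarrow> a \<le> u \<Longrightarrow> u \<le> t \<Longrightarrow> t \<le> v \<Longrightarrow> v \<le> b \<Longrightarrow>
      norm (F v - F u - \<phi> t * (\<gamma> v - \<gamma> u)) \<le> \<epsilon> * (W v - W u)"
  shows "norm ((\<Sum>(t, K)\<in>p. \<phi> t * (\<gamma> (Sup K) - \<gamma> (Inf K))) - (F b - F a)) \<le> \<epsilon> * (W b - W a)"
proof -
  have tele: "(\<Sum>(t, K)\<in>p. F (Sup K) - F (Inf K)) = F b - F a"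
    by (rule additive_tagged_division_1[OF \<open>a \<le> b\<close> p])
  have "norm ((\<Sum>(t, K)\<in>p. \<phi> t * (\<gamma> (Sup K) - \<gamma> (Inf K))) - (F b - F a))
      = norm (\<Sum>(t, K)\<in>p. (F (Sup K) - F (Inf K)) - \<phi> t * (\<gamma> (Sup K) - \<gamma> (Inf K)))"
    unfolding tele[symmetric] by (subst norm_minus_commute) (simp add: sum_subtractf case_prod_unfold)
  also have "\<dots> \<le> (\<Sum>(t, K)\<in>p. \<epsilon> * (W (Sup K) - W (Inf K)))"
  proof (rule sum_norm_le)
    fix x assume x: "x \<in> p"
    obtain t K where xe: "x = (t, K)" by (cases x)
    obtain u v where K: "K = {u..v}" "a \<le> u" "u \<le> t" "t \<le> v" "v \<le> b"
      using tagged_division_ofE_real[OF p x[unfolded xe]] .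
    show "norm (case x of (t, K) \<Rightarrow> (F (Sup K) - F (Inf K)) - \<phi> t * (\<gamma> (Sup K) - \<gamma> (Inf K)))
        \<le> (case x of (t, K) \<Rightarrow> \<epsilon> * (W (Sup K) - W (Inf K)))"
      using err[OF x[unfolded xe K(1)] K(2-5)] K xe by simp
  qed
  also have "\<dots> = \<epsilon> * (\<Sum>(t, K)\<in>p. W (Sup K) - W (Inf K))"
    by (simp add: sum_distrib_left case_prod_unfold)
  also have "\<dots> = \<epsilon> * (W b - W a)"
    by (simp only: additive_tagged_division_1[OF \<open>a \<le> b\<close> p])
  finally show ?thesis .
qed

text \<open>
  Subtracting the constant \<open>w\<close> from the integrand subtracts \<open>w (\<gamma> d - \<gamma> c)\<close> from the integral, and
  an integrand of modulus at most \<open>\<epsilon>\<close> has an integral of modulus at most \<open>\<epsilon> (W d - W c)\<close>.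
\<close>

lemma has_path_integral_near_constant:
  assumes int: "has_path_integral g I (c, d, \<gamma>)" and "c \<le> d"
    and maj: "majorizes W \<gamma> {c..d}"
    and near: "\<And>t. t \<in> {c..d} \<Longrightarrow> norm (g (\<gamma> t) - w) \<le> \<epsilon>"
  shows "norm (I - w * (\<gamma> d - \<gamma> c)) \<le> \<epsilon> * (W d - W c)"
proof (rule field_le_epsilon)
  fix \<eta> :: real assume "\<eta> > 0"
  obtain \<delta> where "\<delta> > 0" and \<delta>: "\<forall>p. p tagged_division_of {c..d} \<and>
      (\<forall>(t, K)\<in>p. Sup K - Inf K < \<delta>) \<longrightarrow>
      norm ((\<Sum>(t, K)\<in>p. g (\<gamma> t) * (\<gamma> (Sup K) - \<gamma> (Inf K))) - I) < \<eta>"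
    using mp[OF spec[OF int[unfolded has_path_integral.simps]] \<open>\<eta> > 0\<close>] by (elim exE conjE)
  have "gauge (\<lambda>t::real. ball t (\<delta>/2))" using \<open>\<delta> > 0\<close> by (intro gauge_ball) simp
  then obtain p where p: "p tagged_division_of {c..d}" and fine: "(\<lambda>t. ball t (\<delta>/2)) fine p"
    by (rule fine_division_exists_real)
  have mesh: "\<forall>(t, K)\<in>p. Sup K - Inf K < \<delta>"
  proof clarify
    fix t K assume tK: "(t, K) \<in> p"
    obtain u v where K: "K = {u..v}" "c \<le> u" "u \<le> t" "t \<le> v" "v \<le> d"
      using tagged_division_ofE_real[OF p tK] .
    have "K \<subseteq> ball t (\<delta>/2)" using fineD[OF fine tK] .
    then have "u \<in> ball t (\<delta>/2)" "v \<in> ball t (\<delta>/2)" by (rule subsetD, use K in simp)+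
    then show "Sup K - Inf K < \<delta>" using K by (simp add: dist_real_def)
  qed
  let ?S = "\<Sum>(t, K)\<in>p. g (\<gamma> t) * (\<gamma> (Sup K) - \<gamma> (Inf K))"
  have "norm (?S - (w * \<gamma> d - w * \<gamma> c)) \<le> \<epsilon> * (W d - W c)"
  proof (rule tagged_division_sum_error[OF p \<open>c \<le> d\<close>])
    fix t u v assume "c \<le> u" "u \<le> t" "t \<le> v" "v \<le> d"
    then have 1: "norm (g (\<gamma> t) - w) \<le> \<epsilon>" and 2: "norm (\<gamma> v - \<gamma> u) \<le> W v - W u"
      using near[of t] majorizesD[OF maj, of u v] by auto
    have "w * \<gamma> v - w * \<gamma> u - g (\<gamma> t) * (\<gamma> v - \<gamma> u) = - ((g (\<gamma> t) - w) * (\<gamma> v - \<gamma> u))"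
      by (simp add: algebra_simps)
    then have "norm (w * \<gamma> v - w * \<gamma> u - g (\<gamma> t) * (\<gamma> v - \<gamma> u))
        = norm (g (\<gamma> t) - w) * norm (\<gamma> v - \<gamma> u)"
      by (simp only: norm_minus_cancel norm_mult)
    also have "\<dots> \<le> \<epsilon> * (W v - W u)"
      by (rule mult_mono[OF 1 2 order_trans[OF norm_ge_zero 1] norm_ge_zero])
    finally show "norm (w * \<gamma> v - w * \<gamma> u - g (\<gamma> t) * (\<gamma> v - \<gamma> u)) \<le> \<epsilon> * (W v - W u)" .
  qed
  moreover have "norm (?S - I) < \<eta>" using \<delta> p mesh by blast
  moreover have "norm (I - w * (\<gamma> d - \<gamma> c))
      \<le> norm (?S - (w * \<gamma> d - w * \<gamma> c)) + norm (?S - I)"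
    using norm_triangle_ineq4[of "?S - (w * \<gamma> d - w * \<gamma> c)" "?S - I"] by (simp add: algebra_simps)
  ultimately show "norm (I - w * (\<gamma> d - \<gamma> c)) \<le> \<epsilon> * (W d - W c) + \<eta>" by simp
qed

text \<open>
  Errors are measured against the increments of \<open>W\<close>, because neither \<open>d - c\<close> nor \<open>\<bar>\<gamma> d - \<gamma> c\<bar>\<close>
  would do: the increments of a rectifiable path can be much larger than \<open>d - c\<close>, and a path that
  returns to \<open>\<gamma> c\<close> at time \<open>d\<close> can contribute to an integral over \<open>[c,d]\<close> although \<open>\<gamma> d - \<gamma> c = 0\<close>.
\<close>

definition increment_estimate ::
  "(real \<Rightarrow> complex) \<Rightarrow> (real \<Rightarrow> real) \<Rightarrow> real \<Rightarrow> real \<Rightarrow> (real \<Rightarrow> complex) \<Rightarrow> (real \<Rightarrow> complex) \<Rightarrow> bool" where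
  "increment_estimate \<gamma> W a b F \<phi> \<longleftrightarrow>
     (\<forall>\<epsilon>>0. \<exists>\<delta>>0. \<forall>c t d. a \<le> c \<and> c \<le> t \<and> t \<le> d \<and> d \<le> b \<and> d - c < \<delta> \<longrightarrow>
        norm (F d - F c - \<phi> t * (\<gamma> d - \<gamma> c)) \<le> \<epsilon> * (W d - W c))"

lemma increment_estimateE:
  assumes "increment_estimate \<gamma> W a b F \<phi>" "\<epsilon> > 0"
  obtains \<delta> where "\<delta> > 0"
    "\<And>c t d. a \<le> c \<Longrightarrow> c \<le> t \<Longrightarrow> t \<le> d \<Longrightarrow> d \<le> b \<Longrightarrow> d - c < \<delta> \<Longrightarrow>
      norm (F d - F c - \<phi> t * (\<gamma> d - \<gamma> c)) \<le> \<epsilon> * (W d - W c)"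
  using mp[OF spec[OF assms(1)[unfolded increment_estimate_def]] assms(2)]
proof (elim exE conjE)
  fix \<delta> :: real
  assume "\<delta> > 0" and "\<forall>c t d. a \<le> c \<and> c \<le> t \<and> t \<le> d \<and> d \<le> b \<and> d - c < \<delta> \<longrightarrow>
      norm (F d - F c - \<phi> t * (\<gamma> d - \<gamma> c)) \<le> \<epsilon> * (W d - W c)"
  then show thesis by (intro that[of \<delta>]) simp_all
qed

lemma increment_estimate_imp_has_path_integral:
  assumes "increment_estimate \<gamma> W a b F (\<lambda>t. g (\<gamma> t))" "a \<le> b" "majorizes W \<gamma> {a..b}"
  shows "has_path_integral g (F b - F a) (a, b, \<gamma>)"
  unfolding has_path_integral.simps
proof (intro allI impI)
  fix \<epsilon> :: real assume "\<epsilon> > 0"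
  have W: "0 \<le> W b - W a"
    using order_trans[OF norm_ge_zero majorizesD[OF assms(3), of a b]] assms(2) by simp
  \<comment> \<open>The summand \<open>1\<close> is for the case \<open>W b = W a\<close>, possible if \<open>\<gamma>\<close> is constant.\<close>
  define \<eta> where "\<eta> = \<epsilon> / (W b - W a + 1)"
  have "\<eta> > 0" using \<open>\<epsilon> > 0\<close> W by (simp add: \<eta>_def)
  obtain \<delta> where "\<delta> > 0" and
    \<delta>: "\<And>c t d. a \<le> c \<Longrightarrow> c \<le> t \<Longrightarrow> t \<le> d \<Longrightarrow> d \<le> b \<Longrightarrow> d - c < \<delta> \<Longrightarrow>
        norm (F d - F c - g (\<gamma> t) * (\<gamma> d - \<gamma> c)) \<le> \<eta> * (W d - W c)"
    by (rule increment_estimateE[OF assms(1) \<open>\<eta> > 0\<close>]) (rule that)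
  have "norm ((\<Sum>(t, K)\<in>p. g (\<gamma> t) * (\<gamma> (Sup K) - \<gamma> (Inf K))) - (F b - F a)) < \<epsilon>"
    if p: "p tagged_division_of {a..b}" and mesh: "\<forall>(t, K)\<in>p. Sup K - Inf K < \<delta>" for p
  proof -
    have "norm ((\<Sum>(t, K)\<in>p. g (\<gamma> t) * (\<gamma> (Sup K) - \<gamma> (Inf K))) - (F b - F a)) \<le> \<eta> * (W b - W a)"
    proof (rule tagged_division_sum_error[OF p \<open>a \<le> b\<close>])
      fix t u v assume *: "(t, {u..v}) \<in> p" "a \<le> u" "u \<le> t" "t \<le> v" "v \<le> b"
      then have "v - u < \<delta>" using mesh by fastforce
      then show "norm (F v - F u - g (\<gamma> t) * (\<gamma> v - \<gamma> u)) \<le> \<eta> * (W v - W u)"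
        using * by (intro \<delta>)
    qed
    also have "\<dots> < \<epsilon>" using W \<open>\<epsilon> > 0\<close> by (simp add: \<eta>_def field_simps)
    finally show ?thesis .
  qed
  then show "\<exists>\<delta>>0. \<forall>p. p tagged_division_of {a..b} \<and> (\<forall>(t, K)\<in>p. Sup K - Inf K < \<delta>) \<longrightarrow>
      norm ((\<Sum>(t, K)\<in>p. g (\<gamma> t) * (\<gamma> (Sup K) - \<gamma> (Inf K))) - (F b - F a)) < \<epsilon>"
    using \<open>\<delta> > 0\<close> by blast
qed

lemma uniform_continuity_interval:
  fixes h :: "real \<Rightarrow> complex"
  assumes "continuous_on {a..b} h" "\<epsilon> > 0"
  obtains \<delta> where "\<delta> > 0"
    "\<And>s t. s \<in> {a..b} \<Longrightarrow> t \<in> {a..b} \<Longrightarrow> \<bar>s - t\<bar> < \<delta> \<Longrightarrow> norm (h s - h t) \<le> \<epsilon>"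
proof -
  have "uniformly_continuous_on {a..b} h"
    using assms(1) by (intro compact_uniformly_continuous) auto
  then obtain \<delta> where "\<delta> > 0"
    "\<forall>t\<in>{a..b}. \<forall>s\<in>{a..b}. dist s t < \<delta> \<longrightarrow> dist (h s) (h t) < \<epsilon>"
    using assms(2) unfolding uniformly_continuous_on_def by blast
  then show ?thesis by (intro that[of \<delta>]) (auto simp: dist_norm less_imp_le)
qed

lemma continuous_bounded_interval:
  fixes h :: "real \<Rightarrow> complex"
  assumes "continuous_on {a..b} h"
  obtains M where "M \<ge> 1" "\<And>t. t \<in> {a..b} \<Longrightarrow> norm (h t) \<le> M"
proof -
  have "bounded (h ` {a..b})"
    using assms by (intro compact_imp_bounded compact_continuous_image) auto
  then obtain B where "\<forall>t\<in>{a..b}. norm (h t) \<le> B" by (auto simp: bounded_iff)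
  then show ?thesis by (intro that[of "max 1 B"]) (auto simp: le_max_iff_disj)
qed

text \<open>
  With \<open>r = 1 / G\<close> and \<open>q = F / G\<close>, the increment of \<open>q\<close> over \<open>[c,d]\<close> is
  \<open>r d (F d - F c) - q c r d (G d - G c)\<close>. The estimates for \<open>F\<close> and \<open>G\<close> replace the increments
  there, and uniform continuity of \<open>r\<close> and \<open>q\<close> moves the coefficients to the tag \<open>t\<close>.
\<close>

lemma increment_estimate_divide:
  assumes F: "increment_estimate \<gamma> W a b F \<phi>" and G: "increment_estimate \<gamma> W a b G \<psi>"
    and cont: "continuous_on {a..b} F" "continuous_on {a..b} G"
      "continuous_on {a..b} \<phi>" "continuous_on {a..b} \<psi>"
    and nz: "\<And>t. t \<in> {a..b} \<Longrightarrow> G t \<noteq> 0"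
    and maj: "majorizes W \<gamma> {a..b}"
  shows "increment_estimate \<gamma> W a b (\<lambda>t. F t / G t) (\<lambda>t. (G t * \<phi> t - F t * \<psi> t) / (G t)\<^sup>2)"
  unfolding increment_estimate_def
proof (intro allI impI)
  fix \<epsilon> :: real assume "\<epsilon> > 0"
  define r where "r t = 1 / G t" for t
  define q where "q t = F t / G t" for t
  have cont_r: "continuous_on {a..b} r" and cont_q: "continuous_on {a..b} q"
    unfolding r_def q_def using cont nz by (auto intro!: continuous_intros)
  obtain M1 where M1: "M1 \<ge> 1" "\<And>t. t \<in> {a..b} \<Longrightarrow> norm (r t) \<le> M1"
    by (rule continuous_bounded_interval[OF cont_r]) (rule that)
  obtain M2 where M2: "M2 \<ge> 1" "\<And>t. t \<in> {a..b} \<Longrightarrow> norm (q t) \<le> M2"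
    by (rule continuous_bounded_interval[OF cont_q]) (rule that)
  obtain M3 where M3: "M3 \<ge> 1" "\<And>t. t \<in> {a..b} \<Longrightarrow> norm (\<phi> t) \<le> M3"
    by (rule continuous_bounded_interval[OF cont(3)]) (rule that)
  obtain M4 where M4: "M4 \<ge> 1" "\<And>t. t \<in> {a..b} \<Longrightarrow> norm (\<psi> t) \<le> M4"
    by (rule continuous_bounded_interval[OF cont(4)]) (rule that)
  define M where "M = max (max M1 M2) (max M3 M4)"
  have M: "M \<ge> 1" using M1 by (simp add: M_def)
  have bd: "norm (r t) \<le> M" "norm (q t) \<le> M" "norm (\<phi> t) \<le> M" "norm (\<psi> t) \<le> M"
    if "t \<in> {a..b}" for t
    using M1(2)[OF that] M2(2)[OF that] M3(2)[OF that] M4(2)[OF that] by (auto simp: M_def)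
  \<comment> \<open>The five error terms below contribute \<open>M\<close>, \<open>M\<^sup>2\<close>, \<open>M\<close>, \<open>M\<^sup>2\<close> and \<open>M\<^sup>2\<close> times \<open>\<eta>\<close>.\<close>
  define \<eta> where "\<eta> = \<epsilon> / (5 * M\<^sup>2)"
  have "\<eta> > 0" using \<open>\<epsilon> > 0\<close> M by (simp add: \<eta>_def)
  obtain \<delta>1 where "\<delta>1 > 0" and
    \<delta>1: "\<And>c t d. a \<le> c \<Longrightarrow> c \<le> t \<Longrightarrow> t \<le> d \<Longrightarrow> d \<le> b \<Longrightarrow> d - c < \<delta>1 \<Longrightarrow>
        norm (F d - F c - \<phi> t * (\<gamma> d - \<gamma> c)) \<le> \<eta> * (W d - W c)"
    by (rule increment_estimateE[OF F \<open>\<eta> > 0\<close>]) (rule that)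
  obtain \<delta>2 where "\<delta>2 > 0" and
    \<delta>2: "\<And>c t d. a \<le> c \<Longrightarrow> c \<le> t \<Longrightarrow> t \<le> d \<Longrightarrow> d \<le> b \<Longrightarrow> d - c < \<delta>2 \<Longrightarrow>
        norm (G d - G c - \<psi> t * (\<gamma> d - \<gamma> c)) \<le> \<eta> * (W d - W c)"
    by (rule increment_estimateE[OF G \<open>\<eta> > 0\<close>]) (rule that)
  obtain \<delta>3 where "\<delta>3 > 0" and
    \<delta>3: "\<And>s t. s \<in> {a..b} \<Longrightarrow> t \<in> {a..b} \<Longrightarrow> \<bar>s - t\<bar> < \<delta>3 \<Longrightarrow> norm (r s - r t) \<le> \<eta>"
    by (rule uniform_continuity_interval[OF cont_r \<open>\<eta> > 0\<close>]) (rule that)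
  obtain \<delta>4 where "\<delta>4 > 0" and
    \<delta>4: "\<And>s t. s \<in> {a..b} \<Longrightarrow> t \<in> {a..b} \<Longrightarrow> \<bar>s - t\<bar> < \<delta>4 \<Longrightarrow> norm (q s - q t) \<le> \<eta>"
    by (rule uniform_continuity_interval[OF cont_q \<open>\<eta> > 0\<close>]) (rule that)
  define \<delta> where "\<delta> = min (min \<delta>1 \<delta>2) (min \<delta>3 \<delta>4)"
  have "\<delta> > 0" using \<open>\<delta>1 > 0\<close> \<open>\<delta>2 > 0\<close> \<open>\<delta>3 > 0\<close> \<open>\<delta>4 > 0\<close> by (simp add: \<delta>_def)
  moreover have "norm (F d / G d - F c / G c - (G t * \<phi> t - F t * \<psi> t) / (G t)\<^sup>2 * (\<gamma> d - \<gamma> c))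
      \<le> \<epsilon> * (W d - W c)"
    if "a \<le> c" "c \<le> t" "t \<le> d" "d \<le> b" "d - c < \<delta>" for c t d
  proof -
    have mem: "c \<in> {a..b}" "t \<in> {a..b}" "d \<in> {a..b}" using that by auto
    define V where "V = W d - W c"
    have \<gamma>: "norm (\<gamma> d - \<gamma> c) \<le> V"
      unfolding V_def using majorizesD[OF maj mem(1,3)] that by simp
    then have "V \<ge> 0" by (rule order_trans[OF norm_ge_zero])
    define eF where "eF = F d - F c - \<phi> t * (\<gamma> d - \<gamma> c)"
    define eG where "eG = G d - G c - \<psi> t * (\<gamma> d - \<gamma> c)"
    have e: "norm eF \<le> \<eta> * V" "norm eG \<le> \<eta> * V"
      unfolding eF_def eG_def V_def using that by (auto intro!: \<delta>1 \<delta>2 simp: \<delta>_def)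
    have n: "norm (r d - r t) \<le> \<eta>" "norm (q c - q t) \<le> \<eta>"
      using that mem by (auto intro!: \<delta>3 \<delta>4 simp: \<delta>_def)
    define T1 where "T1 = r d * eF"
    define T2 where "T2 = q c * r d * eG"
    define T3 where "T3 = (r d - r t) * \<phi> t * (\<gamma> d - \<gamma> c)"
    define T4 where "T4 = (q c - q t) * r d * \<psi> t * (\<gamma> d - \<gamma> c)"
    define T5 where "T5 = q t * (r d - r t) * \<psi> t * (\<gamma> d - \<gamma> c)"
    have G0: "G c \<noteq> 0" "G t \<noteq> 0" "G d \<noteq> 0" using nz mem by auto
    have 1: "F d / G d - F c / G c = r d * (F d - F c) - q c * r d * (G d - G c)"
      using G0 by (simp add: r_def q_def field_simps)
    have 2: "(G t * \<phi> t - F t * \<psi> t) / (G t)\<^sup>2 = r t * \<phi> t - q t * r t * \<psi> t"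
      using G0 by (simp add: r_def q_def field_simps power2_eq_square)
    have split: "F d / G d - F c / G c - (G t * \<phi> t - F t * \<psi> t) / (G t)\<^sup>2 * (\<gamma> d - \<gamma> c)
        = T1 - T2 + T3 - T4 - T5"
      unfolding 1 2 T1_def T2_def T3_def T4_def T5_def eF_def eG_def by (simp add: algebra_simps)
    have M0: "0 \<le> M" "M \<le> M\<^sup>2" using M by (auto simp: power2_eq_square)
    have "M * (\<eta> * V) \<le> M\<^sup>2 * (\<eta> * V)"
      using M0 \<open>\<eta> > 0\<close> \<open>V \<ge> 0\<close> by (intro mult_right_mono) auto
    moreover have "norm T1 \<le> M * (\<eta> * V)"
      unfolding T1_def norm_mult using bd mem e M0 by (intro mult_mono) auto
    moreover have "norm T2 \<le> M * M * (\<eta> * V)"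
      unfolding T2_def norm_mult using bd mem e M0 by (intro mult_mono) auto
    moreover have "norm T3 \<le> \<eta> * M * V"
      unfolding T3_def norm_mult using bd mem n \<gamma> M0 \<open>\<eta> > 0\<close> by (intro mult_mono) auto
    moreover have "norm T4 \<le> \<eta> * M * M * V"
      unfolding T4_def norm_mult using bd mem n \<gamma> M0 \<open>\<eta> > 0\<close> by (intro mult_mono) auto
    moreover have "norm T5 \<le> M * \<eta> * M * V"
      unfolding T5_def norm_mult using bd mem n \<gamma> M0 \<open>\<eta> > 0\<close> by (intro mult_mono) auto
    ultimately have "norm T1 + norm T2 + norm T3 + norm T4 + norm T5 \<le> 5 * (M\<^sup>2 * (\<eta> * V))"
      by (simp add: power2_eq_square mult_ac)
    also have "\<dots> = \<epsilon> * V" using M by (simp add: \<eta>_def)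
    finally have "norm T1 + norm T2 + norm T3 + norm T4 + norm T5 \<le> \<epsilon> * V" .
    moreover have "norm (T1 - T2 + T3 - T4 - T5)
        \<le> norm T1 + norm T2 + norm T3 + norm T4 + norm T5"
      using norm_triangle_ineq4[of "T1 - T2 + T3 - T4" T5] norm_triangle_ineq4[of "T1 - T2 + T3" T4]
        norm_triangle_ineq[of "T1 - T2" T3] norm_triangle_ineq4[of T1 T2] by linarith
    ultimately show ?thesis unfolding split V_def by simp
  qed
  ultimately show "\<exists>\<delta>>0. \<forall>c t d. a \<le> c \<and> c \<le> t \<and> t \<le> d \<and> d \<le> b \<and> d - c < \<delta> \<longrightarrow>
      norm (F d / G d - F c / G c - (G t * \<phi> t - F t * \<psi> t) / (G t)\<^sup>2 * (\<gamma> d - \<gamma> c))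
        \<le> \<epsilon> * (W d - W c)"
    by blast
qed

section \<open>Derivatives along an effective collection\<close>

lemma effective_pathD:
  assumes "effective X \<F>" "\<F> \<subseteq> paths_in X" "(a, b, \<gamma>) \<in> \<F>"
  shows "a < b" "continuous_on {a..b} \<gamma>" "\<gamma> ` {a..b} \<subseteq> X" "rectifiable (a, b, \<gamma>)"
proof -
  have "is_path (a, b, \<gamma>)" "path_img (a, b, \<gamma>) \<subseteq> X"
    using assms(2,3) by (auto simp: paths_in_def simp del: is_path.simps path_img.simps)
  then show "a < b" "continuous_on {a..b} \<gamma>" "\<gamma> ` {a..b} \<subseteq> X" by auto
  show "rectifiable (a, b, \<gamma>)"
    using assms(1,3) by (auto simp: effective_def admissible_def)
qed

lemma effective_path_continuous_on:
  assumes "effective X \<F>" "\<F> \<subseteq> paths_in X" "(a, b, \<gamma>) \<in> \<F>" "continuous_on X h"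
  shows "continuous_on {a..b} (\<lambda>t. h (\<gamma> t))"
  using assms(4) effective_pathD(2,3)[OF assms(1-3)] by (rule continuous_on_compose2)

text \<open>
  Closure of \<open>\<F>\<close> under subpaths is what makes the integral condition a local one.
\<close>

lemma F_derivative_increment_near:
  assumes "F_derivative X \<F> f f'" "effective X \<F>" "(a, b, \<gamma>) \<in> \<F>"
    and "a \<le> c" "c \<le> d" "d \<le> b" "majorizes W \<gamma> {c..d}"
    and near: "\<And>t. t \<in> {c..d} \<Longrightarrow> norm (f' (\<gamma> t) - w) \<le> \<epsilon>"
  shows "norm (f (\<gamma> d) - f (\<gamma> c) - w * (\<gamma> d - \<gamma> c)) \<le> \<epsilon> * (W d - W c)"
proof (cases "c = d")
  case False
  then have "c < d" using assms by simp
  let ?\<gamma> = "restrict \<gamma> {c..d}"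
  have "(c, d, ?\<gamma>) \<in> subpaths (a, b, \<gamma>)" using assms \<open>c < d\<close> by auto
  then have "(c, d, ?\<gamma>) \<in> \<F>" using assms unfolding effective_def by blast
  then have "has_path_integral f' (f (?\<gamma> d) - f (?\<gamma> c)) (c, d, ?\<gamma>)"
    using assms(1) unfolding F_derivative_def by blast
  then have "norm (f (?\<gamma> d) - f (?\<gamma> c) - w * (?\<gamma> d - ?\<gamma> c)) \<le> \<epsilon> * (W d - W c)"
    by (rule has_path_integral_near_constant[OF _ \<open>c \<le> d\<close> majorizes_restrict[OF assms(7)]])
      (simp add: near)
  then show ?thesis using \<open>c \<le> d\<close> by simp
qed simp

lemma F_derivative_increment_estimate:
  assumes "F_derivative X \<F> f f'" "effective X \<F>" "\<F> \<subseteq> paths_in X" "(a, b, \<gamma>) \<in> \<F>"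
    and maj: "majorizes W \<gamma> {a..b}"
  shows "increment_estimate \<gamma> W a b (\<lambda>t. f (\<gamma> t)) (\<lambda>t. f' (\<gamma> t))"
  unfolding increment_estimate_def
proof (intro allI impI)
  fix \<epsilon> :: real assume "\<epsilon> > 0"
  have "continuous_on X f'" using assms(1) by (simp add: F_derivative_def cont_functions_def)
  then have cont: "continuous_on {a..b} (\<lambda>t. f' (\<gamma> t))"
    by (rule effective_path_continuous_on[OF assms(2-4)])
  obtain \<delta> where "\<delta> > 0" and \<delta>: "\<And>s t. s \<in> {a..b} \<Longrightarrow> t \<in> {a..b} \<Longrightarrow> \<bar>s - t\<bar> < \<delta> \<Longrightarrow>
      norm (f' (\<gamma> s) - f' (\<gamma> t)) \<le> \<epsilon>"
    by (rule uniform_continuity_interval[OF cont \<open>\<epsilon> > 0\<close>]) (rule that)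
  have "norm (f (\<gamma> d) - f (\<gamma> c) - f' (\<gamma> t) * (\<gamma> d - \<gamma> c)) \<le> \<epsilon> * (W d - W c)"
    if "a \<le> c" "c \<le> t" "t \<le> d" "d \<le> b" "d - c < \<delta>" for c t d
  proof (rule F_derivative_increment_near[OF assms(1,2,4)])
    show "majorizes W \<gamma> {c..d}" using majorizes_subset[OF maj] that by simp
    show "norm (f' (\<gamma> s) - f' (\<gamma> t)) \<le> \<epsilon>" if "s \<in> {c..d}" for s
      using that \<open>a \<le> c\<close> \<open>c \<le> t\<close> \<open>t \<le> d\<close> \<open>d \<le> b\<close> \<open>d - c < \<delta>\<close> by (intro \<delta>) auto
  qed (use that in auto)
  then show "\<exists>\<delta>>0. \<forall>c t d. a \<le> c \<and> c \<le> t \<and> t \<le> d \<and> d \<le> b \<and> d - c < \<delta> \<longrightarrow>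
      norm (f (\<gamma> d) - f (\<gamma> c) - f' (\<gamma> t) * (\<gamma> d - \<gamma> c)) \<le> \<epsilon> * (W d - W c)"
    using \<open>\<delta> > 0\<close> by blast
qed

lemma shrinking_majorant_constant:
  assumes maj: "majorizes W \<gamma> {c..d}"
    and halve: "\<And>W. majorizes W \<gamma> {c..d} \<Longrightarrow> majorizes (\<lambda>t. W t / 2) \<gamma> {c..d}"
  shows "\<gamma> constant_on {c..d}"
proof -
  have pow: "majorizes (\<lambda>t. W t / 2 ^ n) \<gamma> {c..d}" for n
  proof (induction n)
    case 0
    show ?case using maj by simp
  next
    case (Suc n)
    from halve[OF this] show ?case by (simp add: mult.commute)
  qed
  have "\<gamma> t = \<gamma> c" if t: "t \<in> {c..d}" for t
  proof -
    have "(\<lambda>n. (W t - W c) * (1/2) ^ n) \<longlonglongrightarrow> (W t - W c) * 0"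
      by (intro tendsto_mult_left LIMSEQ_power_zero) simp
    moreover have "norm (\<gamma> t - \<gamma> c) \<le> (W t - W c) * (1/2) ^ n" for n
      using majorizesD[OF pow[of n], of c t] t by (simp add: field_simps)
    ultimately have "norm (\<gamma> t - \<gamma> c) \<le> 0"
      by (intro LIMSEQ_le_const[of _ 0]) auto
    then show ?thesis by simp
  qed
  then show ?thesis unfolding constant_on_def by blast
qed

text \<open>
  Where the derivatives differ by about \<open>w\<^sub>1 - w\<^sub>2 \<noteq> 0\<close>, both \<open>w\<^sub>1 (\<gamma> v - \<gamma> u)\<close> and \<open>w\<^sub>2 (\<gamma> v - \<gamma> u)\<close>
  approximate the same increment of \<open>f\<close>, with an error that is a small multiple of any bound
  for the increments of \<open>\<gamma>\<close>. So every such bound can be halved.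
\<close>

lemma F_derivative_unique_on_path:
  assumes D: "F_derivative X \<F> f g1" "F_derivative X \<F> f g2"
    and eff: "effective X \<F>" "\<F> \<subseteq> paths_in X" "(a, b, \<gamma>) \<in> \<F>" and s: "s \<in> {a..b}"
  shows "g1 (\<gamma> s) = g2 (\<gamma> s)"
proof (rule ccontr)
  define w1 where "w1 = g1 (\<gamma> s)"
  define w2 where "w2 = g2 (\<gamma> s)"
  \<comment> \<open>Two errors of \<open>\<epsilon> (W v - W u)\<close> then add up to half of \<open>\<bar>w1 - w2\<bar> (W v - W u)\<close>.\<close>
  define \<epsilon> where "\<epsilon> = norm (w1 - w2) / 4"
  assume "g1 (\<gamma> s) \<noteq> g2 (\<gamma> s)"
  then have "\<epsilon> > 0" by (simp add: \<epsilon>_def w1_def w2_def)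
  note path = effective_pathD[OF eff]
  have "continuous_on X g1" "continuous_on X g2"
    using D by (auto simp: F_derivative_def cont_functions_def)
  then have cont: "continuous_on {a..b} (\<lambda>t. g1 (\<gamma> t))" "continuous_on {a..b} (\<lambda>t. g2 (\<gamma> t))"
    by (auto intro: effective_path_continuous_on[OF eff])
  obtain \<delta>1 where "\<delta>1 > 0" and \<delta>1: "\<And>t t'. t \<in> {a..b} \<Longrightarrow> t' \<in> {a..b} \<Longrightarrow> \<bar>t - t'\<bar> < \<delta>1 \<Longrightarrow>
      norm (g1 (\<gamma> t) - g1 (\<gamma> t')) \<le> \<epsilon>"
    by (rule uniform_continuity_interval[OF cont(1) \<open>\<epsilon> > 0\<close>]) (rule that)
  obtain \<delta>2 where "\<delta>2 > 0" and \<delta>2: "\<And>t t'. t \<in> {a..b} \<Longrightarrow> t' \<in> {a..b} \<Longrightarrow> \<bar>t - t'\<bar> < \<delta>2 \<Longrightarrow>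
      norm (g2 (\<gamma> t) - g2 (\<gamma> t')) \<le> \<epsilon>"
    by (rule uniform_continuity_interval[OF cont(2) \<open>\<epsilon> > 0\<close>]) (rule that)
  define \<delta> where "\<delta> = min \<delta>1 \<delta>2 / 2"
  have \<delta>: "0 < \<delta>" "\<delta> < \<delta>1" "\<delta> < \<delta>2" using \<open>\<delta>1 > 0\<close> \<open>\<delta>2 > 0\<close> by (auto simp: \<delta>_def)
  define c where "c = max a (s - \<delta>)"
  define d where "d = min b (s + \<delta>)"
  have cd: "a \<le> c" "c < d" "d \<le> b"
    using s \<open>a < b\<close> \<delta> by (auto simp: c_def d_def)
  have near1: "norm (g1 (\<gamma> t) - w1) \<le> \<epsilon>" and near2: "norm (g2 (\<gamma> t) - w2) \<le> \<epsilon>"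
    if "t \<in> {c..d}" for t
    using that s \<delta> unfolding w1_def w2_def by (auto intro!: \<delta>1 \<delta>2 simp: c_def d_def)
  obtain W where "majorizes W \<gamma> {a..b}" using rectifiable_majorant[OF path(4)] .
  then have "majorizes W \<gamma> {c..d}" using cd by (elim majorizes_subset) auto
  then have "\<gamma> constant_on {c..d}"
  proof (rule shrinking_majorant_constant)
    fix W assume maj: "majorizes W \<gamma> {c..d}"
    have "norm (\<gamma> v - \<gamma> u) \<le> W v / 2 - W u / 2" if uv: "c \<le> u" "u \<le> v" "v \<le> d" for u v
    proof -
      have m: "majorizes W \<gamma> {u..v}" using maj uv by (elim majorizes_subset) auto
      let ?I = "f (\<gamma> v) - f (\<gamma> u)" and ?\<Delta> = "\<gamma> v - \<gamma> u"
      have "norm (?I - w1 * ?\<Delta>) \<le> \<epsilon> * (W v - W u)"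
        by (rule F_derivative_increment_near[OF D(1) eff(1,3) _ uv(2) _ m])
          (use uv cd near1 in auto)
      moreover have "norm (?I - w2 * ?\<Delta>) \<le> \<epsilon> * (W v - W u)"
        by (rule F_derivative_increment_near[OF D(2) eff(1,3) _ uv(2) _ m])
          (use uv cd near2 in auto)
      moreover have "norm ((w1 - w2) * ?\<Delta>) \<le> norm (?I - w2 * ?\<Delta>) + norm (?I - w1 * ?\<Delta>)"
        using norm_triangle_ineq4[of "?I - w2 * ?\<Delta>" "?I - w1 * ?\<Delta>"] by (simp add: algebra_simps)
      moreover have "norm ((w1 - w2) * ?\<Delta>) = \<epsilon> * (4 * norm ?\<Delta>)"
        by (simp add: norm_mult \<epsilon>_def)
      ultimately have "\<epsilon> * (4 * norm ?\<Delta>) \<le> \<epsilon> * (2 * (W v - W u))" by linarith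
      then have "4 * norm ?\<Delta> \<le> 2 * (W v - W u)"
        using \<open>\<epsilon> > 0\<close> by (simp only: mult_le_cancel_left_pos)
      then show ?thesis by simp
    qed
    then show "majorizes (\<lambda>t. W t / 2) \<gamma> {c..d}" by (simp add: majorizes_def)
  qed
  then have "constant_path (c, d, restrict \<gamma> {c..d})" by (auto simp: constant_on_def)
  moreover have "(c, d, restrict \<gamma> {c..d}) \<in> subpaths (a, b, \<gamma>)" using cd by auto
  ultimately show False using eff unfolding effective_def admissible_def by blast
qed

lemma F_derivative_unique:
  assumes "compact_plane_set X" "effective X \<F>" "\<F> \<subseteq> paths_in X"
    and D: "F_derivative X \<F> f g1" "F_derivative X \<F> f g2"
  shows "g1 = g2"
proof -
  define S where "S = (\<Union>\<Gamma>\<in>\<F>. path_img \<Gamma>)"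
  have S: "S \<subseteq> X" "X \<subseteq> closure S"
    using assms(2) by (auto simp: effective_def dense_in_def S_def)
  have "closed X" using assms(1) by (simp add: compact_plane_set_def compact_imp_closed)
  then have X: "closure S = X" using S closure_minimal by blast
  have g: "g1 \<in> extensional X" "g2 \<in> extensional X" "continuous_on X g1" "continuous_on X g2"
    using D by (auto simp: F_derivative_def cont_functions_def)
  have eq: "g1 z - g2 z = 0" if "z \<in> S" for z
    using that F_derivative_unique_on_path[OF D assms(2,3)] by (auto simp: S_def)
  have "continuous_on (closure S) (\<lambda>z. g1 z - g2 z)"
    unfolding X using g(3,4) by (rule continuous_on_diff)
  then have "g1 z - g2 z = 0" if "z \<in> closure S" for z
    using eq that by (rule continuous_constant_on_closure)
  then show ?thesis using g(1,2) X by (intro extensionalityI[of _ X]) auto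
qed

lemma F_deriv_eqI:
  assumes "compact_plane_set X" "effective X \<F>" "\<F> \<subseteq> paths_in X" "F_derivative X \<F> f f'"
  shows "F_deriv X \<F> f = f'"
  unfolding F_deriv_def using assms F_derivative_unique by blast

text \<open>
  The quotient rule for increments applies on each path, with the compositions \<open>f \<circ> \<gamma>\<close> and \<open>g \<circ> \<gamma>\<close>
  in the role of the functions and a common majorant \<open>W\<close>; the resulting estimate yields the path
  integral of the claimed derivative.
\<close>

lemma F_derivative_divide:
  assumes "effective X \<F>" "\<F> \<subseteq> paths_in X"
    and f: "F_derivative X \<F> f f'" and g: "F_derivative X \<F> g g'" and nz: "0 \<notin> g ` X"
  shows "F_derivative X \<F> (\<lambda>z\<in>X. f z / g z) (\<lambda>z\<in>X. (g z * f' z - f z * g' z) / (g z)\<^sup>2)"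
    (is "F_derivative X \<F> ?q ?q'")
proof -
  have cont: "continuous_on X f" "continuous_on X g" "continuous_on X f'" "continuous_on X g'"
    using f g by (auto simp: F_derivative_def cont_functions_def)
  have nz': "g z \<noteq> 0" if "z \<in> X" for z using nz that by force
  have "continuous_on X (\<lambda>z. f z / g z)"
    "continuous_on X (\<lambda>z. (g z * f' z - f z * g' z) / (g z)\<^sup>2)"
    using cont nz' by (auto intro!: continuous_intros)
  then have "?q \<in> cont_functions X" "?q' \<in> cont_functions X"
    by (auto simp: cont_functions_def cong: continuous_on_cong)
  moreover have "has_path_integral ?q' (?q (\<gamma> b) - ?q (\<gamma> a)) (a, b, \<gamma>)" if \<gamma>: "(a, b, \<gamma>) \<in> \<F>" for a b \<gamma>
  proof -
    note path = effective_pathD[OF assms(1,2) \<gamma>]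
    obtain W where W: "majorizes W \<gamma> {a..b}" using rectifiable_majorant[OF path(4)] .
    have c: "continuous_on {a..b} (\<lambda>t. h (\<gamma> t))" if "continuous_on X h" for h :: "complex \<Rightarrow> complex"
      using that by (rule effective_path_continuous_on[OF assms(1,2) \<gamma>])
    have inX: "\<gamma> t \<in> X" if "a \<le> t" "t \<le> b" for t using path(3) that by auto
    have "increment_estimate \<gamma> W a b (\<lambda>t. f (\<gamma> t) / g (\<gamma> t))
        (\<lambda>t. (g (\<gamma> t) * f' (\<gamma> t) - f (\<gamma> t) * g' (\<gamma> t)) / (g (\<gamma> t))\<^sup>2)"
      using F_derivative_increment_estimate[OF f assms(1,2) \<gamma> W]
        F_derivative_increment_estimate[OF g assms(1,2) \<gamma> W] c cont nz' inX W
      by (intro increment_estimate_divide) auto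
    then have "increment_estimate \<gamma> W a b (\<lambda>t. ?q (\<gamma> t)) (\<lambda>t. ?q' (\<gamma> t))"
      unfolding increment_estimate_def using inX by (smt (verit) restrict_apply')
    then show ?thesis
      using increment_estimate_imp_has_path_integral[of \<gamma> W a b "\<lambda>t. ?q (\<gamma> t)" ?q'] path(1) W by simp
  qed
  ultimately show ?thesis unfolding F_derivative_def by blast
qed

theorem corollary4p3:
  fixes X :: "complex set" and \<F> :: "plane_path set" and f g :: "complex \<Rightarrow> complex"
  assumes "compact_plane_set X" and "semi_rectifiable X"
    and "\<F> \<subseteq> paths_in X" and "effective X \<F>"
    and "f \<in> F_differentiable_functions X \<F>" and "g \<in> F_differentiable_functions X \<F>"
    and "0 \<notin> g ` X"
  shows "(\<lambda>z\<in>X. f z / g z) \<in> F_differentiable_functions X \<F> \<and>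
    F_deriv X \<F> (\<lambda>z\<in>X. f z / g z) =
      (\<lambda>z\<in>X. (g z * F_deriv X \<F> f z - f z * F_deriv X \<F> g z) / (g z)\<^sup>2)"
proof -
  obtain f' where f': "F_derivative X \<F> f f'"
    using assms(5) by (auto simp: F_differentiable_functions_def)
  obtain g' where g': "F_derivative X \<F> g g'"
    using assms(6) by (auto simp: F_differentiable_functions_def)
  note D = F_derivative_divide[OF assms(4,3) f' g' assms(7)]
  note deriv = F_deriv_eqI[OF assms(1,4,3)]
  have "(\<lambda>z\<in>X. f z / g z) \<in> cont_functions X"
    using D unfolding F_derivative_def by (rule conjunct1)
  then have "(\<lambda>z\<in>X. f z / g z) \<in> F_differentiable_functions X \<F>"
    unfolding F_differentiable_functions_def using D by blast
  then show ?thesis using deriv[OF D] deriv[OF f'] deriv[OF g'] by simp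
qed

end
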